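(* Let $n$ be a natural number and let $m,k,c,h,c_h,v_d,h_0,c_a,c_d$ be real numbers with $0<m$, $0<k$, $0<c$, $0<h$, $0<c_h$, $0<v_d$, $0<h_0$, $0<c_a$, $0<c_d$ and $1<n$. Let $x:\mathbb{N}\to(\mathbb{R}\to\mathbb{C})$ be the horizontal-distance (inter-vehicle spacing) functions of the platoon, and define the spacing errors $z_j(t)=x_j(t)-x_{j+1}(t)$ for $j\in\mathbb{N}$, $t\in\mathbb{R}$. Let $\omega$ be a real number with $0<\omega$ and $\frac{2k}{m}<\omega^2$, and put $s=i\omega$. Assume: (i) $z_n$ is twice differentiable and $z_{n-1}$ is differentiable (on $\mathbb{R}$); (ii) each of $z_n, z_n', z_n'', z_{n-1}, z_{n-1}'$ satisfies the Laplace existence condition at $s$; (iii) zero initial conditions hold: $z_n(0)=z_n'(0)=0$ and $z_{n-1}(0)=0$; (iv) $s^2+\frac{c}{m}s+\frac{k}{m}\neq 0$ and $Z_{n-1}(s)\neq 0$; (v) (autonomous unidirectional controller with constant spacing) for all $t$, $$z_n''(t)+\frac{c}{m}z_n'(t)+\frac{k}{m}z_n(t)=\frac{c}{m}z_{n-1}'(t)+\frac{k}{m}z_{n-1}(t).$$ Then the platoon is stable at $\omega$, i.e. $$\left|\frac{Z_n(i\omega)}{Z_{n-1}(i\omega)}\right|<1,$$ where $Z_j$ denotes the Laplace transform of $z_j$.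
   Context: For $f:\mathbb{R}\to\mathbb{C}$ and $s\in\mathbb{C}$, the Laplace transform is $F(s)=\int_0^\infty f(t)e^{-st}\,dt$. $f$ satisfies the Laplace existence condition at $s$ if $f$ is piecewise differentiable on $[0,b]$ for every $b$, and there exist real $M>0$ and $a$ with $\operatorname{Re}s>a$ and $|f(t)|\le Me^{at}$ for all $t\ge 0$. Derivatives are complex-valued derivatives with respect to the real variable $t$. *)

theory Defs
  imports "HOL-Analysis.Analysis"
begin

definition laplace_transform :: "(real \<Rightarrow> complex) \<Rightarrow> complex \<Rightarrow> complex" where
  "laplace_transform f s = integral {0..} (\<lambda>t. f t * exp (- s * complex_of_real t))"

(* The library's piecewise differentiability on an interval: continuity there, and
   differentiability away from a finite set of points. *)
definition laplace_exists :: "(real \<Rightarrow> complex) \<Rightarrow> complex \<Rightarrow> bool" where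
  "laplace_exists f s \<longleftrightarrow>
     (\<forall>b. f piecewise_differentiable_on {0..b}) \<and>
     (\<exists>M a. 0 < M \<and> a < Re s \<and> (\<forall>t\<ge>0. cmod (f t) \<le> M * exp (a * t)))"

(* The derivative of a complex-valued function of a real variable; it is meaningful
   only where the function is differentiable. *)
definition real_deriv :: "(real \<Rightarrow> complex) \<Rightarrow> real \<Rightarrow> complex" where
  "real_deriv f t = vector_derivative f (at t)"

definition spacing_error :: "(nat \<Rightarrow> real \<Rightarrow> complex) \<Rightarrow> nat \<Rightarrow> real \<Rightarrow> complex" where
  "spacing_error x j t = x j t - x (Suc j) t"

definition platoon_stable_at :: "(nat \<Rightarrow> real \<Rightarrow> complex) \<Rightarrow> nat \<Rightarrow> real \<Rightarrow> bool" where
  "platoon_stable_at x n \<omega> \<longleftrightarrow>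
     cmod (laplace_transform (spacing_error x n) (\<i> * complex_of_real \<omega>) /
           laplace_transform (spacing_error x (n - 1)) (\<i> * complex_of_real \<omega>)) < 1"

end

theory Submission
  imports Defs
begin

text \<open>For \<open>s = \<i>\<omega>\<close> the decay of the functions makes the Laplace integrals converge
  absolutely, and integration by parts turns the controller equation into
  \<open>(s\<^sup>2 + (c/m) s + k/m) Z\<^sub>n = ((c/m) s + k/m) Z\<^sub>n\<^sub>-\<^sub>1\<close>.  On the imaginary axis both factors have
  imaginary part \<open>c\<omega>/m\<close>, while their real parts are \<open>k/m - \<omega>\<^sup>2\<close> and \<open>k/m\<close>; the first one is
  larger in modulus exactly when \<open>\<omega>\<^sup>2 > 2k/m\<close>.\<close>

text \<open>Piecewise differentiability includes continuity on each \<open>{0..b}\<close>, and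
  continuity is local: below \<open>t + 1\<close> the sets \<open>{0..t+1}\<close> and
  \<open>{0..}\<close> have the same points.\<close>

lemma laplace_exists_continuous_on:
  assumes "laplace_exists f s"
  shows "continuous_on {0..} f"
proof -
  have cont: "continuous_on {0..b} f" for b :: real
    using assms by (auto simp: laplace_exists_def piecewise_differentiable_on_def)
  have "continuous (at t within {0..}) f" if "t \<in> {0..}" for t
  proof -
    have "continuous (at t within {0..t+1}) f"
      using cont[of "t+1"] that
      by (auto simp: continuous_on_eq_continuous_within)
    moreover have "at t within {0..t+1} = at t within {0..}"
      by (rule at_within_nhd[where S="{..<t+1}"]) auto
    ultimately show ?thesis by simp
  qed
  then show ?thesis by (simp add: continuous_on_eq_continuous_within)
qed

text \<open>The kernel has modulus \<open>exp (- Re s * t)\<close>, so growth of order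
  \<open>a < Re s\<close> leaves decay at the rate \<open>r = Re s - a\<close>. This one bound
  serves both integrability and the vanishing of boundary terms.\<close>

lemma norm_laplace_integrand_le:
  assumes "laplace_exists f s"
  obtains M r where "0 < r"
    "\<And>t. 0 \<le> t \<Longrightarrow> cmod (f t * exp (- s * complex_of_real t)) \<le> M * exp (- r * t)"
proof -
  obtain M a where a: "a < Re s" and bd: "\<And>t. t \<ge> 0 \<Longrightarrow> cmod (f t) \<le> M * exp (a * t)"
    using assms unfolding laplace_exists_def by blast
  show ?thesis
  proof (rule that[of "Re s - a" M])
    fix t :: real assume "0 \<le> t"
    have "cmod (f t * exp (- s * complex_of_real t)) \<le> M * exp (a * t) * exp (- Re s * t)"
      using bd[OF \<open>0 \<le> t\<close>] by (simp add: norm_mult norm_exp_eq_Re)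
    also have "\<dots> = M * exp (- (Re s - a) * t)"
      by (simp add: mult.assoc exp_add [symmetric] algebra_simps)
    finally show "cmod (f t * exp (- s * complex_of_real t)) \<le> M * exp (- (Re s - a) * t)" .
  qed (use a in auto)
qed

lemma laplace_integrand_absolutely_integrable:
  assumes "laplace_exists f s"
  shows "(\<lambda>t. f t * exp (- s * complex_of_real t)) absolutely_integrable_on {0..}"
proof -
  obtain M r where r: "0 < r"
    and bd: "\<And>t. 0 \<le> t \<Longrightarrow> cmod (f t * exp (- s * complex_of_real t)) \<le> M * exp (- r * t)"
    using norm_laplace_integrand_le[OF assms] by blast
  show ?thesis
  proof (rule measurable_bounded_by_integrable_imp_absolutely_integrable)
    show "(\<lambda>t. f t * exp (- s * complex_of_real t)) \<in> borel_measurable (lebesgue_on {0..})"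
      by (intro continuous_imp_measurable_on_sets_lebesgue continuous_intros
            laplace_exists_continuous_on[OF assms]) auto
    show "(\<lambda>t. M * exp (- r * t)) integrable_on {0..}"
      by (intro integrable_on_mult_right integrable_on_exp_minus_to_infinity r)
  qed (use bd in auto)
qed

text \<open>This removes the boundary term at infinity in the integration by parts.\<close>

lemma laplace_integrand_tendsto_0:
  assumes "laplace_exists f s"
  shows "((\<lambda>t. f t * exp (- s * complex_of_real t)) \<longlongrightarrow> 0) at_top"
proof -
  obtain M r where r: "0 < r"
    and bd: "\<And>t. 0 \<le> t \<Longrightarrow> cmod (f t * exp (- s * complex_of_real t)) \<le> M * exp (- r * t)"
    using norm_laplace_integrand_le[OF assms] by blast
  have "filterlim (\<lambda>t::real. - r * t) at_bot at_top"
    by (rule filterlim_tendsto_neg_mult_at_bot[OF tendsto_const _ filterlim_ident]) (use r in simp)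
  then have "((\<lambda>t. exp (- r * t)) \<longlongrightarrow> 0) at_top"
    by (rule filterlim_compose[OF exp_at_bot])
  then have "((\<lambda>t. M * exp (- r * t)) \<longlongrightarrow> 0) at_top"
    by (rule tendsto_mult_right_zero)
  then show ?thesis
    by (rule Lim_null_comparison[rotated])
      (use bd in \<open>auto intro: eventually_at_top_linorderI[of 0]\<close>)
qed

text \<open>Integration by parts: apply the fundamental theorem of calculus to \<open>f t\<close>
  times the kernel on \<open>{0..b}\<close>, then let \<open>b\<close> tend to infinity. Only the
  boundary value at 0 survives.\<close>

lemma laplace_transform_real_deriv:
  assumes diff: "f differentiable_on UNIV"
    and f: "laplace_exists f s" and f': "laplace_exists (real_deriv f) s"
  shows "laplace_transform (real_deriv f) s = s * laplace_transform f s - f 0"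
proof -
  define e where "e t = exp (- s * complex_of_real t)" for t
  define g where "g t = real_deriv f t * e t - s * (f t * e t)" for t
  have F: "(\<lambda>t. f t * e t) absolutely_integrable_on {0..}"
    and F': "(\<lambda>t. real_deriv f t * e t) absolutely_integrable_on {0..}"
    unfolding e_def by (intro laplace_integrand_absolutely_integrable f f')+
  have abs: "g absolutely_integrable_on {0..}"
    unfolding g_def by (intro set_integral_diff F F' set_integrable_mult_right)
  have df: "(f has_vector_derivative real_deriv f t) (at t)" for t
    using diff unfolding real_deriv_def differentiable_on_def
    by (simp add: vector_derivative_works)
  have e': "(e has_vector_derivative - s * e t) (at t)" for t
    unfolding e_def by (auto intro!: derivative_eq_intros has_vector_derivative_real_field)
  have g: "((\<lambda>t. f t * e t) has_vector_derivative g t) (at t)" for t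
    using has_vector_derivative_mult[OF df e', of t] by (simp add: g_def algebra_simps)
  have "(g has_integral f b * e b - f 0) {0..b}" if "0 \<le> b" for b
    using fundamental_theorem_of_calculus[OF that, of "\<lambda>t. f t * e t" g]
      g[THEN has_vector_derivative_at_within] by (simp add: e_def)
  \<comment> \<open>Absolute integrability identifies the gauge integral given by the fundamental
    theorem with the Lebesgue integral, for which the limit over growing intervals is
    available.\<close>
  moreover have "g absolutely_integrable_on {0..b}" for b
    by (rule set_integrable_subset[OF abs]) auto
  ultimately have "(LINT t:{0..b}|lebesgue. g t) = f b * e b - f 0" if "0 \<le> b" for b
    using that by (metis set_lebesgue_integral_eq_integral(2) integral_unique)
  then have "\<forall>\<^sub>F b in at_top. f b * e b - f 0 = (LINT t:{0..b}|lebesgue. g t)"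
    by (auto intro: eventually_at_top_linorderI[of 0])
  moreover have "((\<lambda>b. f b * e b - f 0) \<longlongrightarrow> 0 - f 0) at_top"
    unfolding e_def by (intro tendsto_intros laplace_integrand_tendsto_0 f)
  ultimately have "((\<lambda>b. LINT t:{0..b}|lebesgue. g t) \<longlongrightarrow> - f 0) at_top"
    by (simp add: tendsto_cong)
  moreover have "((\<lambda>b. LINT t:{0..b}|lebesgue. g t) \<longlongrightarrow> (LINT t:{0..}|lebesgue. g t)) at_top"
    by (rule tendsto_set_lebesgue_integral_at_top[OF _ abs]) auto
  \<comment> \<open>The integrals over \<open>{0..b}\<close> tend both to \<open>- f 0\<close> and
    to the integral over the half-line, so uniqueness of limits applies.\<close>
  ultimately have "integral {0..} g = - f 0"
    using abs tendsto_unique set_lebesgue_integral_eq_integral(2)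
    by (metis trivial_limit_at_top_linorder)
  moreover have "integral {0..} g = integral {0..} (\<lambda>t. real_deriv f t * e t)
      - s * integral {0..} (\<lambda>t. f t * e t)"
    unfolding g_def using F F'
    by (simp add: integral_diff integrable_on_mult_right set_lebesgue_integral_eq_integral(1))
  ultimately show ?thesis
    by (simp add: laplace_transform_def e_def algebra_simps)
qed

lemma laplace_transform_lincomb:
  assumes "laplace_exists f s" "laplace_exists g s"
  shows "laplace_transform (\<lambda>t. a * f t + b * g t) s
    = a * laplace_transform f s + b * laplace_transform g s"
proof -
  have "(\<lambda>t. a * (f t * exp (- s * complex_of_real t))) integrable_on {0..}"
       "(\<lambda>t. b * (g t * exp (- s * complex_of_real t))) integrable_on {0..}"
    using assms[THEN laplace_integrand_absolutely_integrable, THEN set_lebesgue_integral_eq_integral(1)]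
    by (auto intro: integrable_on_mult_right)
  then show ?thesis
    by (simp add: laplace_transform_def distrib_right mult.assoc integral_add)
qed

text \<open>The leading coefficient 1 matches the left side of the controller equation, as the
  two-term version matches its right side. Additivity rests on the integrability of each
  summand.\<close>

lemma laplace_transform_monic_lincomb:
  assumes "laplace_exists f s" "laplace_exists g s" "laplace_exists h s"
  shows "laplace_transform (\<lambda>t. f t + b * g t + c * h t) s
    = laplace_transform f s + b * laplace_transform g s + c * laplace_transform h s"
proof -
  have "(\<lambda>t. f t * exp (- s * complex_of_real t)) integrable_on {0..}"
       "(\<lambda>t. b * (g t * exp (- s * complex_of_real t))) integrable_on {0..}"
       "(\<lambda>t. c * (h t * exp (- s * complex_of_real t))) integrable_on {0..}"
    using assms[THEN laplace_integrand_absolutely_integrable, THEN set_lebesgue_integral_eq_integral(1)]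
    by (auto intro: integrable_on_mult_right)
  then show ?thesis
    by (simp add: laplace_transform_def distrib_right mult.assoc integral_add integrable_add)
qed

theorem theorem1:
  fixes n :: nat
    and m k c h c_h v_d h_0 c_a c_d \<omega> :: real
    and x z :: "nat \<Rightarrow> real \<Rightarrow> complex"
    and s :: complex
  assumes "0 < m" "0 < k" "0 < c" "0 < h" "0 < c_h" "0 < v_d" "0 < h_0" "0 < c_a" "0 < c_d"
    and "1 < n"
    and z: "z = spacing_error x"
    and "0 < \<omega>" and "2 * k / m < \<omega>\<^sup>2"
    and s: "s = \<i> * complex_of_real \<omega>"
    and "z n differentiable_on UNIV"
    and "real_deriv (z n) differentiable_on UNIV"
    and "z (n - 1) differentiable_on UNIV"
    and "laplace_exists (z n) s"
    and "laplace_exists (real_deriv (z n)) s"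
    and "laplace_exists (real_deriv (real_deriv (z n))) s"
    and "laplace_exists (z (n - 1)) s"
    and "laplace_exists (real_deriv (z (n - 1))) s"
    and "z n 0 = 0" and "real_deriv (z n) 0 = 0" and "z (n - 1) 0 = 0"
    and "s\<^sup>2 + complex_of_real (c / m) * s + complex_of_real (k / m) \<noteq> 0"
    and "laplace_transform (z (n - 1)) s \<noteq> 0"
    and controller: "\<forall>t. real_deriv (real_deriv (z n)) t
             + complex_of_real (c / m) * real_deriv (z n) t + complex_of_real (k / m) * z n t
           = complex_of_real (c / m) * real_deriv (z (n - 1)) t
             + complex_of_real (k / m) * z (n - 1) t"
  shows "platoon_stable_at x n \<omega>"
proof -
  note le = \<open>laplace_exists (z n) s\<close> \<open>laplace_exists (real_deriv (z n)) s\<close>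
    \<open>laplace_exists (real_deriv (real_deriv (z n))) s\<close>
    \<open>laplace_exists (z (n - 1)) s\<close> \<open>laplace_exists (real_deriv (z (n - 1))) s\<close>
  define Y where "Y = laplace_transform (z n) s"
  define X where "X = laplace_transform (z (n - 1)) s"
  define P where "P = s\<^sup>2 + complex_of_real (c / m) * s + complex_of_real (k / m)"
  define Q where "Q = complex_of_real (c / m) * s + complex_of_real (k / m)"
  have Y1: "laplace_transform (real_deriv (z n)) s = s * Y"
    using laplace_transform_real_deriv[OF \<open>z n differentiable_on UNIV\<close> le(1,2)] \<open>z n 0 = 0\<close>
    by (simp add: Y_def)
  \<comment> \<open>The derivative rule is used again, now on \<open>real_deriv (z n)\<close>; its
    zero initial value removes the boundary term.\<close>
  have Y2: "laplace_transform (real_deriv (real_deriv (z n))) s = s\<^sup>2 * Y"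
    using laplace_transform_real_deriv[OF \<open>real_deriv (z n) differentiable_on UNIV\<close> le(2,3)]
      \<open>real_deriv (z n) 0 = 0\<close> by (simp add: Y1 power2_eq_square)
  have X1: "laplace_transform (real_deriv (z (n - 1))) s = s * X"
    using laplace_transform_real_deriv[OF \<open>z (n - 1) differentiable_on UNIV\<close> le(4,5)]
      \<open>z (n - 1) 0 = 0\<close> by (simp add: X_def)
  \<comment> \<open>The controller equation holds at every \<open>t\<close>, so both sides have the
    same transform; linearity and the derivative rules turn it into an algebraic equation.\<close>
  have "P * Y = Q * X"
    using laplace_transform_monic_lincomb[OF le(3,2,1), of "complex_of_real (c / m)" "complex_of_real (k / m)"]
      laplace_transform_lincomb[OF le(5,4), of "complex_of_real (c / m)" "complex_of_real (k / m)"]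
      controller
    unfolding X1 Y1 Y2 X_def[symmetric] Y_def[symmetric] P_def Q_def
    by (simp add: algebra_simps)
  moreover have "P \<noteq> 0" "X \<noteq> 0"
    using assms by (auto simp: P_def X_def)
  ultimately have quotient: "Y / X = Q / P"
    by (simp add: field_simps)
  \<comment> \<open>This product is the difference of squares
    \<open>(k / m - \<omega>\<^sup>2)\<^sup>2 - (k / m)\<^sup>2\<close>, the gap between the squared
    real parts of \<open>P\<close> and \<open>Q\<close>.\<close>
  have "0 < \<omega>\<^sup>2 * (\<omega>\<^sup>2 - 2 * (k / m))"
    using \<open>0 < \<omega>\<close> \<open>2 * k / m < \<omega>\<^sup>2\<close> by simp
  then have "(k / m)\<^sup>2 + (c / m * \<omega>)\<^sup>2 < (k / m - \<omega>\<^sup>2)\<^sup>2 + (c / m * \<omega>)\<^sup>2"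
    by (simp add: power2_eq_square algebra_simps)
  moreover have "P = Complex (k / m - \<omega>\<^sup>2) (c / m * \<omega>)" "Q = Complex (k / m) (c / m * \<omega>)"
    by (simp_all add: P_def Q_def s complex_eq_iff power_mult_distrib flip: of_real_power)
  ultimately have "cmod Q < cmod P"
    by (simp add: complex_norm)
  with quotient have "cmod (Y / X) < 1"
    using \<open>P \<noteq> 0\<close> by (simp add: norm_divide)
  then show ?thesis
    by (simp add: platoon_stable_at_def X_def Y_def z s)
qed

end
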